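(* Let $\mathbb{K}=\mathbb{R}$ or $\mathbb{K}=\mathbb{C}$, let $(X,\|\cdot\|)$ be a normed linear space over $\mathbb{K}$, let $n\ge 1$ be an integer, $(\alpha_1,\dots,\alpha_n)\in\mathbb{K}^n$, $(p_1,\dots,p_n)\in\mathbb{R}_+^n$ with $\sum_{i=1}^n p_i=1$, and $(x_1,\dots,x_n)\in X^n$. If there are $x\in X$ and $R>0$ such that $\|x_i-x\|\le R$ for every $i\in\{1,\dots,n\}$, then $$\left\|\sum_{i=1}^n p_i\alpha_i x_i-\sum_{i=1}^n p_i\alpha_i\cdot\sum_{i=1}^n p_i x_i\right\|\le R\sum_{i=1}^n p_i\left|\alpha_i-\sum_{j=1}^n p_j\alpha_j\right|.$$ Moreover, the constant $1$ on the right-hand side is sharp: if $C>0$ is a constant such that the inequality with $R$ replaced by $CR$ on the right-hand side holds for all normed linear spaces $X$ over $\mathbb{K}$, all integers $n\ge 1$, all $(\alpha_1,\dots,\alpha_n)\in\mathbb{K}^n$, all $(p_1,\dots,p_n)\in\mathbb{R}_+^n$ with $\sum_{i=1}^n p_i=1$, all $(x_1,\dots,x_n)\in X^n$, and all $x\in X$ and $R>0$ with $\|x_i-x\|\le R$ for every $i\in\{1,\dots,n\}$, then $C\ge 1$.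
   Context: $\mathbb{R}_+$ denotes the set of nonnegative real numbers. *)

theory Defs
  imports Complex_Main "HOL-Algebra.Module"
begin

text \<open>
  The real and the complex scalars are treated uniformly as the subfields \<open>\<real>\<close> and \<open>UNIV\<close>
  of the type \<^typ>\<open>complex\<close>.
\<close>

definition scalar_field :: "complex set \<Rightarrow> complex ring" where
  "scalar_field K = \<lparr>carrier = K, monoid.mult = (*), one = 1, zero = 0, add = (+)\<rparr>"

text \<open>
  Spaces are explicit carriers rather than types, since sharpness quantifies over all of them.
  They live inside an arbitrary type \<open>'a\<close>; for sharpness \<open>'a\<close> has to contain a copy of \<open>K\<close>,
  as otherwise the only space over \<open>K\<close> inside \<open>'a\<close> is the zero space.
  A vector space is a module over \<open>scalar_field K\<close>; the fields \<^const>\<open>monoid.mult\<close> and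
  \<^const>\<open>monoid.one\<close> of the module record play no role.
\<close>

locale normed_linear_space = Module.module "scalar_field K" X
  for K :: "complex set" and X :: "(complex, 'a) module" (structure) +
  fixes nrm :: "'a \<Rightarrow> real"
  assumes nrm_nonneg: "v \<in> carrier X \<Longrightarrow> 0 \<le> nrm v"
    and nrm_eq_zero_iff: "v \<in> carrier X \<Longrightarrow> nrm v = 0 \<longleftrightarrow> v = \<zero>\<^bsub>X\<^esub>"
    and nrm_smult: "a \<in> K \<Longrightarrow> v \<in> carrier X \<Longrightarrow> nrm (a \<odot>\<^bsub>X\<^esub> v) = cmod a * nrm v"
    and nrm_triangle:
      "v \<in> carrier X \<Longrightarrow> w \<in> carrier X \<Longrightarrow> nrm (v \<oplus>\<^bsub>X\<^esub> w) \<le> nrm v + nrm w"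

end

theory Submission
  imports Defs
begin

text \<open>
  Put \<open>\<beta>\<^sub>i = p\<^sub>i (\<alpha>\<^sub>i - \<Sum>\<^sub>j p\<^sub>j \<alpha>\<^sub>j)\<close>. These coefficients sum to zero, so the left-hand side is the
  norm of \<open>\<Sum>\<^sub>i \<beta>\<^sub>i (x\<^sub>i - c)\<close> for every centre \<open>c\<close>, and the triangle inequality bounds it by
  \<open>R \<Sum>\<^sub>i |\<beta>\<^sub>i|\<close>. Equality holds in the space \<open>K\<close> for \<open>n = 2\<close>, \<open>p = (1/2, 1/2)\<close>,
  \<open>\<alpha> = x = (-1, 1)\<close>, \<open>c = 0\<close> and \<open>R = 1\<close>.
\<close>

lemma scalar_field_simps [simp]:
  "carrier (scalar_field K) = K" "a \<otimes>\<^bsub>scalar_field K\<^esub> b = a * b" "\<one>\<^bsub>scalar_field K\<^esub> = 1"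
  "\<zero>\<^bsub>scalar_field K\<^esub> = 0" "a \<oplus>\<^bsub>scalar_field K\<^esub> b = a + b"
  by (simp_all add: scalar_field_def)

text \<open>The ring laws are inherited from the complex numbers, so only closure has to be
  supplied. This serves the sharpness example, where the ring structure of \<open>K\<close> must be
  known before any space over \<open>K\<close> exists.\<close>

lemma cring_scalar_field:
  assumes "0 \<in> K" "1 \<in> K" "\<And>a b. a \<in> K \<Longrightarrow> b \<in> K \<Longrightarrow> a + b \<in> K"
    "\<And>a b. a \<in> K \<Longrightarrow> b \<in> K \<Longrightarrow> a * b \<in> K" "\<And>a. a \<in> K \<Longrightarrow> - a \<in> K"
  shows "cring (scalar_field K)"
proof (rule cringI)
  show "abelian_group (scalar_field K)"
    by (rule abelian_groupI) (use assms in \<open>auto simp: algebra_simps intro: bexI[of _ "- _"]\<close>)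
  show "comm_monoid (scalar_field K)"
    by (rule comm_monoidI) (use assms in \<open>auto simp: algebra_simps\<close>)
qed (simp add: algebra_simps)

context normed_linear_space
begin

lemma scalar_minus_closed: "a \<in> K \<Longrightarrow> b \<in> K \<Longrightarrow> a - b \<in> K"
proof -
  assume a: "a \<in> K" and b: "b \<in> K"
  \<comment> \<open>The inverse in the ring record is only given abstractly; as a solution of
    \<open>b + y = 0\<close> it must be the complex number \<open>- b\<close>.\<close>
  have "\<ominus>\<^bsub>scalar_field K\<^esub> b \<in> K" "b + (\<ominus>\<^bsub>scalar_field K\<^esub> b) = 0"
    using R.a_inv_closed[of b] R.r_neg[of b] b by simp_all
  then have "- b \<in> K" by (metis add_eq_0_iff)
  then show ?thesis using R.a_closed[of a "- b"] a by simp
qed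

lemma scalar_mult_closed: "a \<in> K \<Longrightarrow> b \<in> K \<Longrightarrow> a * b \<in> K"
  using R.m_closed[of a b] by simp

lemma scalar_sum_closed: "(\<And>i. i \<in> A \<Longrightarrow> b i \<in> K) \<Longrightarrow> sum b A \<in> K"
proof (induction A rule: infinite_finite_induct)
  case (insert i A)
  then show ?case using R.a_closed[of "b i" "sum b A"] by simp
qed (use R.zero_closed in simp_all)

text \<open>Used with coefficients of sum zero, to make the contribution of a fixed vector
  vanish.\<close>

lemma finsum_smult_rdistr:
  assumes "finite A" "\<And>i. i \<in> A \<Longrightarrow> b i \<in> K" "v \<in> carrier X"
  shows "(\<Oplus>i\<in>A. b i \<odot> v) = sum b A \<odot> v"
  using assms
proof (induction A)
  case empty
  then show ?case using smult_l_null[of v] by simp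
next
  case (insert i A)
  have "(\<Oplus>j\<in>insert i A. b j \<odot> v) = b i \<odot> v \<oplus> (\<Oplus>j\<in>A. b j \<odot> v)"
    using insert smult_closed by (subst M.finsum_insert) auto
  then show ?case
    using insert smult_l_distr[of "b i" "sum b A" v] scalar_sum_closed[of A b] by simp
qed

lemma nrm_finsum_le:
  assumes "finite A" "\<And>i. i \<in> A \<Longrightarrow> v i \<in> carrier X"
  shows "nrm (\<Oplus>i\<in>A. v i) \<le> (\<Sum>i\<in>A. nrm (v i))"
  using assms
proof (induction A)
  case empty
  then show ?case using nrm_eq_zero_iff[of \<zero>] by simp
next
  case (insert i A)
  have "(\<Oplus>j\<in>insert i A. v j) = v i \<oplus> (\<Oplus>j\<in>A. v j)"
    using insert by (subst M.finsum_insert) auto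
  then show ?case
    using insert nrm_triangle[of "v i" "\<Oplus>j\<in>A. v j"] M.finsum_closed[of v A] by fastforce
qed

text \<open>Moving the origin to \<open>c\<close> adds the term
  \<open>sum b A \<odot> (\<ominus> c)\<close>, which is zero because the coefficients cancel. This
  lets the centre of the ball enter the estimate.\<close>

lemma finsum_smult_translate:
  assumes "finite A" "\<And>i. i \<in> A \<Longrightarrow> b i \<in> K" "\<And>i. i \<in> A \<Longrightarrow> x i \<in> carrier X"
    "c \<in> carrier X" "sum b A = 0"
  shows "(\<Oplus>i\<in>A. b i \<odot> (x i \<ominus> c)) = (\<Oplus>i\<in>A. b i \<odot> x i)"
proof -
  have "(\<Oplus>i\<in>A. b i \<odot> (x i \<ominus> c)) = (\<Oplus>i\<in>A. b i \<odot> x i \<oplus> b i \<odot> (\<ominus> c))"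
    using assms smult_closed by (intro M.finsum_cong') (auto simp: a_minus_def smult_r_distr)
  also have "\<dots> = (\<Oplus>i\<in>A. b i \<odot> x i) \<oplus> (\<Oplus>i\<in>A. b i \<odot> (\<ominus> c))"
    using assms smult_closed by (intro M.finsum_addf) auto
  also have "(\<Oplus>i\<in>A. b i \<odot> (\<ominus> c)) = \<zero>"
    using assms finsum_smult_rdistr[of A b "\<ominus> c"] smult_l_null[of "\<ominus> c"] by simp
  finally show ?thesis
    using assms smult_closed by (simp add: Pi_def)
qed

lemma finsum_smult_diff:
  assumes "finite A" "\<And>i. i \<in> A \<Longrightarrow> a i \<in> K" "\<And>i. i \<in> A \<Longrightarrow> q i \<in> K" "d \<in> K"
    "\<And>i. i \<in> A \<Longrightarrow> x i \<in> carrier X"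
  shows "(\<Oplus>i\<in>A. a i \<odot> x i) \<ominus> d \<odot> (\<Oplus>i\<in>A. q i \<odot> x i) = (\<Oplus>i\<in>A. (a i - d * q i) \<odot> x i)"
proof -
  have K: "d * q i \<in> K" "a i - d * q i \<in> K" if "i \<in> A" for i
    using that assms by (simp_all add: scalar_mult_closed scalar_minus_closed)
  have cl: "(\<lambda>i. (a i - d * q i) \<odot> x i) \<in> A \<rightarrow> carrier X" "(\<lambda>i. d \<odot> (q i \<odot> x i)) \<in> A \<rightarrow> carrier X"
    "(\<lambda>i. q i \<odot> x i) \<in> A \<rightarrow> carrier X"
    using K assms smult_closed by auto
  \<comment> \<open>The difference is handled additively: splitting the coefficient
    \<open>a i\<close> this way leaves only sums to distribute, and the second sum is cancelled at
    the end.\<close>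
  have "a i \<odot> x i = (a i - d * q i) \<odot> x i \<oplus> d \<odot> (q i \<odot> x i)" if "i \<in> A" for i
    using that K[OF that] assms smult_l_distr[of "a i - d * q i" "d * q i" "x i"]
      smult_assoc1[of d "q i" "x i"] by simp
  then have "(\<Oplus>i\<in>A. a i \<odot> x i) = (\<Oplus>i\<in>A. (a i - d * q i) \<odot> x i \<oplus> d \<odot> (q i \<odot> x i))"
    using cl by (intro M.finsum_cong') auto
  also have "\<dots> = (\<Oplus>i\<in>A. (a i - d * q i) \<odot> x i) \<oplus> (\<Oplus>i\<in>A. d \<odot> (q i \<odot> x i))"
    using cl by (intro M.finsum_addf)
  also have "(\<Oplus>i\<in>A. d \<odot> (q i \<odot> x i)) = d \<odot> (\<Oplus>i\<in>A. q i \<odot> x i)"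
    using assms cl by (intro finsum_smult_ldistr[symmetric]) auto
  finally show ?thesis
    using cl assms smult_closed[of d] by (simp add: a_minus_def M.a_assoc M.r_neg)
qed

text \<open>The first hypothesis treats real and complex scalars at once: it says that the weights
  \<open>p i\<close> are themselves scalars.\<close>

lemma nrm_chebyshev_functional_le:
  assumes K: "range complex_of_real \<subseteq> K" and A: "finite A"
    and \<alpha>: "\<And>i. i \<in> A \<Longrightarrow> \<alpha> i \<in> K" and p: "\<And>i. i \<in> A \<Longrightarrow> 0 \<le> p i" and p1: "sum p A = 1"
    and x: "\<And>i. i \<in> A \<Longrightarrow> x i \<in> carrier X" and c: "c \<in> carrier X"
    and R: "\<And>i. i \<in> A \<Longrightarrow> nrm (x i \<ominus> c) \<le> R"
  shows "nrm ((\<Oplus>i\<in>A. (complex_of_real (p i) * \<alpha> i) \<odot> x i)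
           \<ominus> (\<Sum>i\<in>A. complex_of_real (p i) * \<alpha> i) \<odot> (\<Oplus>i\<in>A. complex_of_real (p i) \<odot> x i))
         \<le> R * (\<Sum>i\<in>A. p i * cmod (\<alpha> i - (\<Sum>j\<in>A. complex_of_real (p j) * \<alpha> j)))"
proof -
  define m where "m = (\<Sum>j\<in>A. complex_of_real (p j) * \<alpha> j)"
  \<comment> \<open>These are the coefficients that \<open>finsum_smult_diff\<close> produces, with
    \<open>m\<close> as the factor \<open>d\<close> and the weights as \<open>q\<close>.\<close>
  define b where "b i = complex_of_real (p i) * \<alpha> i - m * complex_of_real (p i)" for i
  have pK: "complex_of_real (p i) \<in> K" for i using K by auto
  have mK: "m \<in> K"
    unfolding m_def by (intro scalar_sum_closed scalar_mult_closed pK \<alpha>)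
  have bK: "b i \<in> K" if "i \<in> A" for i
    unfolding b_def using that by (intro scalar_minus_closed scalar_mult_closed pK \<alpha> mK)
  \<comment> \<open>The sum is \<open>m - m * sum p A\<close>, and the weights have total mass
    one.\<close>
  have b0: "sum b A = 0"
    using p1 by (simp add: b_def sum_subtractf m_def[symmetric] flip: sum_distrib_left of_real_sum)
  have cmod_b: "cmod (b i) = p i * cmod (\<alpha> i - m)" if "i \<in> A" for i
  proof -
    have "b i = complex_of_real (p i) * (\<alpha> i - m)" by (simp add: b_def algebra_simps)
    then show ?thesis using p[OF that] by (simp add: norm_mult)
  qed
  have "(\<Oplus>i\<in>A. (complex_of_real (p i) * \<alpha> i) \<odot> x i) \<ominus> m \<odot> (\<Oplus>i\<in>A. complex_of_real (p i) \<odot> x i)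
      = (\<Oplus>i\<in>A. b i \<odot> x i)"
    unfolding b_def using A \<alpha> pK mK x by (intro finsum_smult_diff scalar_mult_closed) auto
  also have "\<dots> = (\<Oplus>i\<in>A. b i \<odot> (x i \<ominus> c))"
    using A bK x c b0 by (intro finsum_smult_translate[symmetric]) auto
  also have "nrm \<dots> \<le> (\<Sum>i\<in>A. nrm (b i \<odot> (x i \<ominus> c)))"
    using A bK x c smult_closed by (intro nrm_finsum_le) auto
  also have "\<dots> \<le> (\<Sum>i\<in>A. R * (p i * cmod (\<alpha> i - m)))"
  proof (rule sum_mono)
    fix i assume i: "i \<in> A"
    have "nrm (b i \<odot> (x i \<ominus> c)) = cmod (b i) * nrm (x i \<ominus> c)"
      using i bK x c by (intro nrm_smult) auto
    also have "\<dots> \<le> cmod (b i) * R" using R[OF i] by (intro mult_left_mono) auto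
    finally show "nrm (b i \<odot> (x i \<ominus> c)) \<le> R * (p i * cmod (\<alpha> i - m))"
      using cmod_b[OF i] by (simp add: mult.commute)
  qed
  finally show ?thesis by (simp add: m_def sum_distrib_left)
qed

end

text \<open>The one-dimensional space \<open>K\<close>, transported into the type \<open>'a\<close>
  along \<open>f\<close>. Decoding uses \<open>inv_into K f\<close> since \<open>f\<close> will be
  injective on \<open>K\<close> only.\<close>

definition scalar_copy :: "complex set \<Rightarrow> (complex \<Rightarrow> 'a) \<Rightarrow> (complex, 'a) module" where
  "scalar_copy K f = \<lparr>carrier = f ` K, monoid.mult = undefined, one = undefined, zero = f 0,
     add = (\<lambda>u v. f (inv_into K f u + inv_into K f v)),
     smult = (\<lambda>a v. f (a * inv_into K f v))\<rparr>"

text \<open>By injectivity, decoding undoes \<open>f\<close> on \<open>K\<close>, so every axiom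
  reduces to an identity or inequality between complex numbers; \<open>f\<close> becomes an isometry
  from \<open>K\<close> with the absolute value.\<close>

lemma normed_linear_space_scalar_copy:
  assumes f: "inj_on f K" and K: "cring (scalar_field K)"
  shows "normed_linear_space K (scalar_copy K f) (\<lambda>v. cmod (inv_into K f v))"
proof -
  interpret cring "scalar_field K" by (rule K)
  \<comment> \<open>Negatives are recorded as solutions of an equation, matching the existential
    form in which \<open>abelian_groupI\<close> asks for inverses.\<close>
  have cl: "0 \<in> K" "1 \<in> K" "a \<in> K \<Longrightarrow> b \<in> K \<Longrightarrow> a + b \<in> K" "a \<in> K \<Longrightarrow> b \<in> K \<Longrightarrow> a * b \<in> K"
    "a \<in> K \<Longrightarrow> \<exists>b\<in>K. a + b = 0" for a b
    using zero_closed one_closed a_closed[of a b] m_closed[of a b] a_inv_closed[of a] r_neg[of a]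
    by auto
  have inv: "inv_into K f (f a) = a" if "a \<in> K" for a
    using f that by (rule inv_into_f_f)
  have inj: "f a = f b \<longleftrightarrow> a = b" if "a \<in> K" "b \<in> K" for a b
    using f that by (auto dest: inj_onD)
  have "abelian_group (scalar_copy K f)"
    by (rule abelian_groupI)
      (auto simp: scalar_copy_def inv cl inj algebra_simps)
  then have "module (scalar_field K) (scalar_copy K f)"
    by (intro moduleI K) (auto simp: scalar_copy_def inv cl inj algebra_simps)
  then show ?thesis
    by (intro normed_linear_space.intro normed_linear_space_axioms.intro)
      (auto simp: scalar_copy_def inv cl inj norm_mult norm_triangle_ineq)
qed

theorem theorem4:
  fixes K :: "complex set"
  assumes "K = \<real> \<or> K = UNIV"
  shows
    "(\<forall>(X :: (complex, 'a) module) nrm (n :: nat) (\<alpha> :: nat \<Rightarrow> complex) (p :: nat \<Rightarrow> real)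
        (x :: nat \<Rightarrow> 'a) (c :: 'a) (R :: real).
        normed_linear_space K X nrm \<longrightarrow> n \<ge> 1 \<longrightarrow>
        (\<forall>i\<in>{1..n}. \<alpha> i \<in> K) \<longrightarrow>
        (\<forall>i\<in>{1..n}. 0 \<le> p i) \<longrightarrow> (\<Sum>i=1..n. p i) = 1 \<longrightarrow>
        (\<forall>i\<in>{1..n}. x i \<in> carrier X) \<longrightarrow>
        c \<in> carrier X \<longrightarrow> R > 0 \<longrightarrow> (\<forall>i\<in>{1..n}. nrm (x i \<ominus>\<^bsub>X\<^esub> c) \<le> R) \<longrightarrow>
        nrm ((\<Oplus>\<^bsub>X\<^esub>i\<in>{1..n}. (complex_of_real (p i) * \<alpha> i) \<odot>\<^bsub>X\<^esub> x i)
             \<ominus>\<^bsub>X\<^esub> (\<Sum>i=1..n. complex_of_real (p i) * \<alpha> i) \<odot>\<^bsub>X\<^esub>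
                 (\<Oplus>\<^bsub>X\<^esub>i\<in>{1..n}. complex_of_real (p i) \<odot>\<^bsub>X\<^esub> x i))
          \<le> R * (\<Sum>i=1..n. p i * cmod (\<alpha> i - (\<Sum>j=1..n. complex_of_real (p j) * \<alpha> j))))
     \<and>
     ((\<exists>f :: complex \<Rightarrow> 'a. inj_on f K) \<longrightarrow>
      (\<forall>C :: real. C > 0 \<longrightarrow>
        (\<forall>(X :: (complex, 'a) module) nrm (n :: nat) (\<alpha> :: nat \<Rightarrow> complex) (p :: nat \<Rightarrow> real)
          (x :: nat \<Rightarrow> 'a) (c :: 'a) (R :: real).
          normed_linear_space K X nrm \<longrightarrow> n \<ge> 1 \<longrightarrow>
          (\<forall>i\<in>{1..n}. \<alpha> i \<in> K) \<longrightarrow>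
          (\<forall>i\<in>{1..n}. 0 \<le> p i) \<longrightarrow> (\<Sum>i=1..n. p i) = 1 \<longrightarrow>
          (\<forall>i\<in>{1..n}. x i \<in> carrier X) \<longrightarrow>
          c \<in> carrier X \<longrightarrow> R > 0 \<longrightarrow> (\<forall>i\<in>{1..n}. nrm (x i \<ominus>\<^bsub>X\<^esub> c) \<le> R) \<longrightarrow>
          nrm ((\<Oplus>\<^bsub>X\<^esub>i\<in>{1..n}. (complex_of_real (p i) * \<alpha> i) \<odot>\<^bsub>X\<^esub> x i)
               \<ominus>\<^bsub>X\<^esub> (\<Sum>i=1..n. complex_of_real (p i) * \<alpha> i) \<odot>\<^bsub>X\<^esub>
                   (\<Oplus>\<^bsub>X\<^esub>i\<in>{1..n}. complex_of_real (p i) \<odot>\<^bsub>X\<^esub> x i))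
            \<le> C * R * (\<Sum>i=1..n. p i * cmod (\<alpha> i - (\<Sum>j=1..n. complex_of_real (p j) * \<alpha> j))))
        \<longrightarrow> C \<ge> 1))"
proof (intro conjI allI impI, goal_cases)
  case (1 X nrm n \<alpha> p x c R)
  then interpret normed_linear_space K X nrm by simp
  show ?case
    using 1 assms by (intro nrm_chebyshev_functional_le) auto
next
  case (2 C)
  then obtain f :: "complex \<Rightarrow> 'a" where f: "inj_on f K" by blast
  have K: "0 \<in> K" "1 \<in> K" "-1 \<in> K" "1/2 \<in> K" "-1/2 \<in> K"
    using assms by auto
  have cring: "cring (scalar_field K)"
    using assms by (intro cring_scalar_field) auto
  define X where "X = scalar_copy K f"
  define nrm where "nrm v = cmod (inv_into K f v)" for v
  define \<alpha> :: "nat \<Rightarrow> complex" where "\<alpha> i = (if i = 1 then -1 else 1)" for i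
  \<comment> \<open>The vectors are the scalars \<open>\<alpha> i\<close> themselves, read in the
    copy of \<open>K\<close>.\<close>
  define x where "x i = f (\<alpha> i)" for i
  have space: "normed_linear_space K X nrm"
    unfolding X_def nrm_def by (rule normed_linear_space_scalar_copy[OF f cring])
  interpret normed_linear_space K X nrm by (rule space)
  have inv: "inv_into K f (f a) = a" if "a \<in> K" for a
    using f that by (rule inv_into_f_f)
  have carrier: "f a \<in> carrier X" if "a \<in> K" for a
    using that by (simp add: X_def scalar_copy_def)
  have \<alpha>: "\<alpha> i \<in> K" for i using K by (simp add: \<alpha>_def)
  have x: "x i \<in> carrier X" for i by (simp add: x_def carrier \<alpha>)
  have zero: "f 0 = \<zero>\<^bsub>X\<^esub>" by (simp add: X_def scalar_copy_def)
  have smult: "a \<odot>\<^bsub>X\<^esub> f b = f (a * b)" if "b \<in> K" for a b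
    using that by (simp add: X_def scalar_copy_def inv)
  have add: "f a \<oplus>\<^bsub>X\<^esub> f b = f (a + b)" if "a \<in> K" "b \<in> K" for a b
    using that by (simp add: X_def scalar_copy_def inv)
  have minus_zero: "v \<ominus>\<^bsub>X\<^esub> \<zero>\<^bsub>X\<^esub> = v" if "v \<in> carrier X" for v
    using that M.add.inv_one by (simp add: a_minus_def)
  \<comment> \<open>Stated with \<open>Suc 0\<close> because the simplifier rewrites the lower bound
    \<open>1\<close> to it.\<close>
  have two: "{Suc 0..2} = {1, 2}" by auto
  have sum2: "(\<Oplus>\<^bsub>X\<^esub>i\<in>{1..2::nat}. v i) = v 1 \<oplus>\<^bsub>X\<^esub> v 2"
    if "v 1 \<in> carrier X" "v 2 \<in> carrier X" for v
    using that by (simp add: two M.finsum_insert)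
  \<comment> \<open>Both terms equal \<open>f (1/2)\<close>, as the square of each
    \<open>\<alpha> i\<close> is 1, whereas in the plain means below the opposite signs
    cancel.\<close>
  have weighted: "(\<Oplus>\<^bsub>X\<^esub>i\<in>{1..2::nat}. (complex_of_real (1/2) * \<alpha> i) \<odot>\<^bsub>X\<^esub> x i) = f 1"
    using K by (subst sum2) (simp_all add: x_def \<alpha>_def smult add carrier)
  have mean: "(\<Oplus>\<^bsub>X\<^esub>i\<in>{1..2::nat}. complex_of_real (1/2) \<odot>\<^bsub>X\<^esub> x i) = \<zero>\<^bsub>X\<^esub>"
    using K by (subst sum2) (simp_all add: x_def \<alpha>_def smult add carrier flip: zero)
  have \<alpha>_mean: "(\<Sum>i=1..2. complex_of_real (1/2) * \<alpha> i) = 0"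
    by (simp add: two \<alpha>_def)
  have dist: "nrm (x i \<ominus>\<^bsub>X\<^esub> \<zero>\<^bsub>X\<^esub>) \<le> 1" for i
    using K by (simp add: minus_zero x nrm_def) (simp add: x_def inv \<alpha> \<alpha>_def)
  \<comment> \<open>In this instance the left-hand side is the norm of \<open>f 1\<close>, which is
    1, and the mean absolute deviation on the right is also 1, so the inequality reads
    \<open>1 \<le> C\<close>.\<close>
  have "nrm ((\<Oplus>\<^bsub>X\<^esub>i\<in>{1..2}. (complex_of_real (1/2) * \<alpha> i) \<odot>\<^bsub>X\<^esub> x i)
             \<ominus>\<^bsub>X\<^esub> (\<Sum>i=1..2. complex_of_real (1/2) * \<alpha> i) \<odot>\<^bsub>X\<^esub>
                 (\<Oplus>\<^bsub>X\<^esub>i\<in>{1..2}. complex_of_real (1/2) \<odot>\<^bsub>X\<^esub> x i))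
      \<le> C * 1 * (\<Sum>i=1..2. 1/2 * cmod (\<alpha> i - (\<Sum>j=1..2. complex_of_real (1/2) * \<alpha> j)))"
    using 2(3)[rule_format, of X nrm 2 \<alpha> "\<lambda>_. 1/2" x "\<zero>\<^bsub>X\<^esub>" 1] space \<alpha> x dist by simp
  moreover have "0 \<odot>\<^bsub>X\<^esub> \<zero>\<^bsub>X\<^esub> = \<zero>\<^bsub>X\<^esub>" using smult_l_null[of "\<zero>\<^bsub>X\<^esub>"] by simp
  moreover have "nrm (f 1) = 1" using K by (simp add: nrm_def inv)
  moreover have "(\<Sum>i=1..2. 1/2 * cmod (\<alpha> i)) = 1" by (simp add: two \<alpha>_def)
  ultimately show "1 \<le> C"
    unfolding weighted mean \<alpha>_mean using K by (simp add: minus_zero carrier)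
qed

end
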